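(* Let $S: Ax=b$ be a system of linear equations, where $A\in M_{3\times 7}(\mathbb{Z})$. Suppose that $S=\{s_1,\dots,s_N\}\subset\mathbb{Z}^7$ is the set of solutions of the system, and let $k$ be a positive odd integer such that every prime divisor $p$ of $k$ satisfies $p\equiv 1\pmod 4$, with $u,t\in\mathbb{Z}$. If the system is given by $$\begin{pmatrix} a_{11}&-a_{12}&a_{13}&-a_{14}&0&0&0\\ a_{21}&-a_{22}&a_{23}&0&4a_{25}&4a_{26}&4a_{27}\\ -3a_{31}&0&a_{33}&0&4a_{35}&4a_{36}&4a_{37}\end{pmatrix}\begin{pmatrix}c_1\\c_2\\c_3\\c_4\\c_5\\c_6\\c_7\end{pmatrix}=\begin{pmatrix}k^2\\4u-1\\4t-1\end{pmatrix}$$ and the entries satisfy $a_{11}=a_{21}=a_{31}$, $a_{12}=a_{22}$, $a_{13}=a_{23}=a_{33}$, and $s_i=(c_1,\dots,c_7)\in S$, then there exists an elliptic curve $$E_{s_i}: Y^2=a_{11}c_1X^3+a_{12}c_2X^2+a_{13}c_3X+a_{14}c_4.$$ If $x>1$ and $y\ge 1$ hold for all $(x,y)\in E_{s_i}(\mathbb{Z}^+)$, then $\{E_{s_i}(\mathbb{Z}^+)\}_{i=1}^N=\emptyset$, that is, $E_{s_i}(\mathbb{Z}^+)=\emptyset$ for every $i=1,\dots,N$.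
   Context: The $a_{ij}$ are integers. The letter $S$ denotes both the linear system and its set of solutions. For a curve $E$ given by an equation in $X,Y$ with integer coefficients, $E(\mathbb{Z}^+)$ denotes the set of points $(x,y)$ on $E$ whose coordinates are positive integers.
   Formalization: That E_{s_i} is an elliptic curve is claimed only when a_11c_1 and the cubic's discriminant are nonzero; otherwise it can fail, e.g. k=1, c_1=...=c_4=1, c_5=c_6=c_7=0 with Y^2=12X^3+20X^2+11X+2=(3X+2)(2X+1)^2. Emptiness is stated for all solutions. *)

theory Defs
  imports
    "HOL-Analysis.Analysis"
    "HOL-Computational_Algebra.Polynomial"
    "HOL-Number_Theory.Cong"
begin

text \<open>
  A plane curve \<open>Y\<^sup>2 = f(X)\<close> with integer coefficients is represented by the
  polynomial \<open>f\<close>; its points are taken over \<open>\<complex>\<close>.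
\<close>

definition curve :: "int poly \<Rightarrow> (complex \<times> complex) set" where
  "curve f = {(x, y). y\<^sup>2 = poly (map_poly of_int f) x}"

definition pos_int_points :: "int poly \<Rightarrow> (int \<times> int) set" where
  "pos_int_points f = {(x, y). 0 < x \<and> 0 < y \<and> (of_int x, of_int y) \<in> curve f}"

text \<open>
  Elliptic means that \<open>f\<close> is a cubic and the curve is smooth: the gradient
  \<open>(- f'(x), 2 y)\<close> of \<open>Y\<^sup>2 - f(X)\<close> vanishes at no complex point of the curve.
  Only affine points have to be inspected, since for \<open>degree f = 3\<close> the unique point
  at infinity \<open>[0 : 1 : 0]\<close> of the projective closure is always smooth (and rational).
\<close>

definition elliptic_curve :: "int poly \<Rightarrow> bool" where
  "elliptic_curve f \<longleftrightarrow> degree f = 3 \<and>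
     (\<forall>(x, y) \<in> curve f. \<not> (2 * y = 0 \<and> poly (pderiv (map_poly of_int f)) x = 0))"

text \<open>The discriminant of \<open>p X\<^sup>3 + q X\<^sup>2 + r X + s\<close>.\<close>

definition cubic_discriminant :: "int \<Rightarrow> int \<Rightarrow> int \<Rightarrow> int \<Rightarrow> int" where
  "cubic_discriminant p q r s =
     q\<^sup>2 * r\<^sup>2 - 4 * p * r ^ 3 - 4 * q ^ 3 * s + 18 * p * q * r * s - 27 * p\<^sup>2 * s\<^sup>2"

end

theory Submission
  imports Defs "HOL-Number_Theory.Residues"
begin

text \<open>
  Write \<open>p = a\<^sub>1\<^sub>1 c\<^sub>1\<close>, \<open>q = a\<^sub>1\<^sub>2 c\<^sub>2\<close>, \<open>r = a\<^sub>1\<^sub>3 c\<^sub>3\<close>, \<open>s = a\<^sub>1\<^sub>4 c\<^sub>4\<close>, so that the curve is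
  \<open>Y\<^sup>2 = f(X)\<close> with \<open>f(X) = p X\<^sup>3 + q X\<^sup>2 + r X + s\<close>. The first row of the system says that
  \<open>f(-1) = -k\<^sup>2\<close>. Hence \<open>X + 1\<close> divides \<open>f(X) + k\<^sup>2\<close>, and an integer point gives a factorization
  \<open>y\<^sup>2 + k\<^sup>2 = (x + 1) g(x)\<close> in which, for \<open>x > 0\<close>, both factors are positive.

  The primes dividing \<open>k\<close> are all \<open>1\<close> modulo \<open>4\<close>, so \<open>-1\<close> being a non-residue modulo primes
  \<open>\<equiv> 3\<close> keeps such primes out of \<open>y\<^sup>2 + k\<^sup>2\<close>, and no positive divisor of \<open>y\<^sup>2 + k\<^sup>2\<close> is \<open>3\<close>
  modulo \<open>4\<close> (lemma \<open>odd_divisor_sum_two_squares_cong_1_mod_4\<close>). As \<open>k\<close> is odd, \<open>y\<^sup>2 + k\<^sup>2\<close> is not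
  divisible by \<open>4\<close> either. The other two rows are designed to make one of the factors violate this:
  together they force \<open>4 dvd q\<close> and \<open>g(x) \<equiv> p x (x - 1) + 3\<close> modulo \<open>4\<close>. If \<open>x \<equiv> 0, 1\<close> then
  \<open>g(x) \<equiv> 3\<close>; if \<open>x \<equiv> 2\<close> then \<open>x + 1 \<equiv> 3\<close>; if \<open>x \<equiv> 3\<close> then \<open>4 dvd x + 1\<close>. All are
  impossible (lemma \<open>no_solution_pos_abscissa\<close>).

  Smoothness is the usual argument that a singular point of \<open>Y\<^sup>2 = f(X)\<close> is a double root of \<open>f\<close>,
  which makes the discriminant vanish.
\<close>

section \<open>Divisors of sums of two squares\<close>

text \<open>
  Otherwise \<open>m\<^sup>2 \<equiv> -n\<^sup>2\<close> with \<open>m\<close> and \<open>n\<close> invertible; since \<open>(p - 1) / 2\<close> is odd, raising to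
  that power yields \<open>1 \<equiv> -1\<close> modulo \<open>p\<close> by Fermat's little theorem.
\<close>

lemma prime_3_mod_4_dvd_sum_two_squares:
  fixes p m n :: nat
  assumes "prime p" and "[p = 3] (mod 4)" and dvd: "p dvd m\<^sup>2 + n\<^sup>2"
  shows "p dvd n"
proof (rule ccontr)
  assume n: "\<not> p dvd n"
  have m: "\<not> p dvd m"
  proof
    assume "p dvd m"
    then have "p dvd m\<^sup>2" by (simp add: power2_eq_square)
    then have "p dvd n\<^sup>2" using dvd by (simp add: dvd_add_right_iff)
    then show False using n \<open>prime p\<close> by (simp add: prime_dvd_power_iff)
  qed
  obtain j where j: "p - 1 = 2 * (2 * j + 1)"
  proof
    have "p mod 4 = 3" using \<open>[p = 3] (mod 4)\<close> by (simp add: cong_def)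
    then show "p - 1 = 2 * (2 * (p div 4) + 1)" by presburger
  qed
  have fermat: "[int a ^ (p - 1) = 1] (mod int p)" if "\<not> p dvd a" for a
    using fermat_theorem[OF \<open>prime p\<close> that] cong_int_iff[of "a ^ (p - 1)" 1 p] by simp
  have "int p dvd int (m\<^sup>2 + n\<^sup>2)" using dvd by (simp only: int_dvd_int_iff)
  then have "[(int m)\<^sup>2 = - (int n)\<^sup>2] (mod int p)"
    by (simp add: cong_iff_dvd_diff)
  then have "[((int m)\<^sup>2) ^ (2 * j + 1) = (- (int n)\<^sup>2) ^ (2 * j + 1)] (mod int p)"
    by (rule cong_pow)
  moreover have "(- (int n)\<^sup>2) ^ (2 * j + 1) = - (((int n)\<^sup>2) ^ (2 * j + 1))"
    by (rule power_minus_odd) simp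
  ultimately have "[int m ^ (p - 1) = - (int n ^ (p - 1))] (mod int p)"
    by (simp only: j power_mult[of _ 2])
  moreover have "[int m ^ (p - 1) = 1] (mod int p)" using fermat[OF m] .
  moreover have "[- (int n ^ (p - 1)) = - 1] (mod int p)"
    using fermat[OF n] by (simp add: cong_minus_minus_iff)
  ultimately have "[1 = - 1] (mod int p)"
    by (meson cong_sym cong_trans)
  then have "int p dvd 2" by (simp add: cong_iff_dvd_diff)
  then have "p \<le> 2" by (auto dest: zdvd_imp_le)
  moreover have "p mod 4 = 3" using \<open>[p = 3] (mod 4)\<close> by (simp add: cong_def)
  ultimately show False using prime_gt_1_nat[OF \<open>prime p\<close>] by (cases "p = 2") auto
qed

lemma int_prime_3_mod_4_dvd_sum_two_squares:
  fixes p m n :: int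
  assumes "prime p" and "[p = 3] (mod 4)" and "p dvd m\<^sup>2 + n\<^sup>2"
  shows "p dvd n"
proof -
  have p: "int (nat p) = p" using prime_gt_0_int[OF \<open>prime p\<close>] by simp
  have "prime (nat p)" using \<open>prime p\<close> prime_int_nat_transfer by blast
  moreover have "[nat p = 3] (mod 4)"
    using assms(2) p cong_int_iff[of "nat p" 3 4] by simp
  moreover have "nat p dvd (nat \<bar>m\<bar>)\<^sup>2 + (nat \<bar>n\<bar>)\<^sup>2"
  proof -
    have "int (nat p) dvd int ((nat \<bar>m\<bar>)\<^sup>2 + (nat \<bar>n\<bar>)\<^sup>2)"
      using assms(3) p by simp
    then show ?thesis by (simp only: int_dvd_int_iff)
  qed
  ultimately have "nat p dvd nat \<bar>n\<bar>" by (rule prime_3_mod_4_dvd_sum_two_squares)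
  then have "int (nat p) dvd int (nat \<bar>n\<bar>)" by (simp only: int_dvd_int_iff)
  then show ?thesis using p by simp
qed

text \<open>Positivity matters: \<open>-1\<close> has no prime divisors, yet is \<open>3\<close> modulo \<open>4\<close>.\<close>

lemma cong_1_mod_4_if_prime_divisors_cong_1:
  fixes d :: int
  assumes "d > 0" and "\<And>p. prime p \<Longrightarrow> p dvd d \<Longrightarrow> [p = 1] (mod 4)"
  shows "[d = 1] (mod 4)"
  using assms
proof (induction d rule: prime_divisors_induct)
  case (unit d)
  then show ?case by simp
next
  case (factor p d)
  have "d > 0" using factor prime_gt_0_int zero_less_mult_pos by blast
  then have "[d = 1] (mod 4)" using factor by simp
  with factor have "[p * d = 1 * 1] (mod 4)" by (intro cong_mult) auto
  then show ?case by simp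
qed simp

text \<open>
  A prime divisor of \<open>d\<close> that is \<open>3\<close> modulo \<open>4\<close> would divide \<open>k\<close>, and the condition on \<open>k\<close>
  excludes that; so the prime divisors of \<open>d\<close> are all \<open>1\<close> modulo \<open>4\<close>.
\<close>

lemma odd_divisor_sum_two_squares_cong_1_mod_4:
  fixes d k y :: int
  assumes "d > 0" "odd d" "d dvd y\<^sup>2 + k\<^sup>2"
    and k_primes: "\<And>p. prime p \<Longrightarrow> p dvd k \<Longrightarrow> [p = 1] (mod 4)"
  shows "[d = 1] (mod 4)"
proof (rule cong_1_mod_4_if_prime_divisors_cong_1)
  fix p :: int assume p: "prime p" "p dvd d"
  have "odd p" using p \<open>odd d\<close> dvd_trans by blast
  then have "p mod 4 = 1 \<or> p mod 4 = 3" by presburger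
  then consider "[p = 1] (mod 4)" | "[p = 3] (mod 4)"
    by (auto simp: cong_def)
  then show "[p = 1] (mod 4)"
  proof cases
    case 2
    have "p dvd k"
      using int_prime_3_mod_4_dvd_sum_two_squares[OF p(1) 2] p(2) assms(3) dvd_trans by blast
    then show ?thesis using k_primes p by blast
  qed
qed fact

section \<open>The obstruction modulo 4\<close>

text \<open>
  The hypotheses \<open>row1\<close>, \<open>row2\<close>, \<open>row3\<close> are what remains of the linear system once the
  multiples of \<open>4\<close> in its last two rows are discarded.
\<close>

lemma no_solution_pos_abscissa:
  fixes k p q r s x y :: int
  assumes k: "odd k" "\<And>l. prime l \<Longrightarrow> l dvd k \<Longrightarrow> [l = 1] (mod 4)"
    and row1: "p - q + r - s = k\<^sup>2"
    and row2: "[p - q + r = 3] (mod 4)"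
    and row3: "[r - 3 * p = 3] (mod 4)"
    and x: "x > 0"
    and eq: "y\<^sup>2 = p * x ^ 3 + q * x\<^sup>2 + r * x + s"
  shows False
proof -
  \<comment> \<open>The quotient of \<open>f(X) - f(-1)\<close> by \<open>X + 1\<close>, evaluated at \<open>x\<close>.\<close>
  define g where "g = p * x\<^sup>2 + (q - p) * x + (r - q + p)"
  have factorization: "y\<^sup>2 + k\<^sup>2 = (x + 1) * g"
    unfolding eq g_def row1[symmetric] by (simp add: algebra_simps power2_eq_square power3_eq_cube)
  have "k \<noteq> 0" using k(1) by auto
  then have "y\<^sup>2 + k\<^sup>2 > 0" by (simp add: add_nonneg_pos)
  then have "g > 0" using factorization x by (simp add: zero_less_mult_iff)
  have not_3_mod_4: "\<not> [d = 3] (mod 4)" if "d > 0" "d dvd (x + 1) * g" for d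
  proof
    assume "[d = 3] (mod 4)"
    then have "d mod 4 = 3" by (simp add: cong_def)
    then have "odd d" by presburger
    then have "[d = 1] (mod 4)"
      using odd_divisor_sum_two_squares_cong_1_mod_4[of d y k] that k(2) factorization by simp
    then show False using \<open>d mod 4 = 3\<close> by (simp add: cong_def)
  qed
  have not_4_dvd: "\<not> 4 dvd (x + 1) * g"
  proof -
    have odd_square: "z\<^sup>2 mod 4 = 1" if "odd z" for z :: int
    proof -
      from that obtain j where "z = 2 * j + 1" by (rule oddE)
      then have "z\<^sup>2 = 1 + 4 * (j\<^sup>2 + j)" by (simp add: algebra_simps power2_eq_square)
      then show ?thesis by (simp only: mod_mult_self2) simp
    qed
    have even_square: "z\<^sup>2 mod 4 = 0" if "even z" for z :: int
      using that by (auto simp: power2_eq_square)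
    have "(y\<^sup>2 mod 4 + k\<^sup>2 mod 4) mod 4 \<noteq> 0"
      using odd_square[OF k(1)] odd_square[of y] even_square[of y] by (cases "even y") auto
    then show ?thesis
      unfolding factorization[symmetric] by (simp add: mod_add_eq dvd_eq_mod_eq_0)
  qed
  have q: "4 dvd q"
  proof -
    have "[r - 3 * p = p - q + r] (mod 4)"
      using row2 row3 by (meson cong_sym cong_trans)
    then have "4 dvd q - 4 * p" by (simp add: cong_iff_dvd_diff algebra_simps)
    then show ?thesis by presburger
  qed
  have g: "[g = p * (x * (x - 1)) + 3] (mod 4)"
  proof -
    have "4 dvd q * x + (p - q + r - 3)"
      using q row2 by (simp add: cong_iff_dvd_diff)
    moreover have "g - (p * (x * (x - 1)) + 3) = q * x + (p - q + r - 3)"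
      unfolding g_def by (simp add: algebra_simps power2_eq_square)
    ultimately show ?thesis by (simp only: cong_iff_dvd_diff)
  qed
  consider "4 dvd x * (x - 1)" | "[x + 1 = 3] (mod 4)" | "4 dvd x + 1"
  proof -
    have "4 dvd x \<or> 4 dvd x - 1 \<or> (x + 1) mod 4 = 3 \<or> 4 dvd x + 1" by presburger
    then show ?thesis using that by (auto simp: cong_def)
  qed
  then show False
  proof cases
    case 1
    then have "[p * (x * (x - 1)) + 3 = 0 + 3] (mod 4)"
      by (intro cong_add cong_refl) (simp add: cong_0_iff)
    with g have "[g = 3] (mod 4)" by (metis add_0 cong_trans)
    then show False using not_3_mod_4 \<open>g > 0\<close> by simp
  next
    case 2
    then show False using not_3_mod_4 x by simp
  next
    case 3
    then show False using not_4_dvd by simp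
  qed
qed

section \<open>Smoothness and integer points of the curve\<close>

text \<open>
  The two equations determine \<open>r\<close> and \<open>s\<close> in terms of \<open>p\<close>, \<open>q\<close>, \<open>z\<close>; after substitution the
  discriminant is the zero polynomial in these three variables.
\<close>

lemma cubic_discriminant_eq_0_if_double_root:
  fixes p q r s :: int and z :: complex
  assumes root: "of_int p * z ^ 3 + of_int q * z\<^sup>2 + of_int r * z + of_int s = 0"
    and deriv: "3 * of_int p * z\<^sup>2 + 2 * of_int q * z + of_int r = 0"
  shows "cubic_discriminant p q r s = 0"
proof -
  have r: "of_int r = - (3 * of_int p * z\<^sup>2 + 2 * of_int q * z)"
    using deriv by (simp only: eq_neg_iff_add_eq_0 ac_simps)
  have s: "of_int s = 2 * of_int p * z ^ 3 + of_int q * z\<^sup>2"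
  proof -
    have "of_int s = - (of_int p * z ^ 3 + of_int q * z\<^sup>2 + of_int r * z)"
      using root by (simp only: eq_neg_iff_add_eq_0 ac_simps)
    then show ?thesis by (simp add: r algebra_simps power2_eq_square power3_eq_cube)
  qed
  have "of_int (cubic_discriminant p q r s) = (0 :: complex)"
    unfolding cubic_discriminant_def by (simp add: r s algebra_simps power2_eq_square power3_eq_cube)
  then show ?thesis by simp
qed

lemma elliptic_curve_if_cubic_discriminant_neq_0:
  assumes "p \<noteq> 0" and "cubic_discriminant p q r s \<noteq> 0"
  shows "elliptic_curve [: s, r, q, p :]"
proof -
  have False if "(x, y) \<in> curve [: s, r, q, p :]" "2 * y = 0"
    "poly (pderiv (map_poly of_int [: s, r, q, p :])) x = 0" for x y
  proof -
    have "of_int p * x ^ 3 + of_int q * x\<^sup>2 + of_int r * x + of_int s = 0"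
      using that(1,2) unfolding curve_def
      by (simp add: map_poly_pCons algebra_simps power2_eq_square power3_eq_cube)
    moreover have "3 * of_int p * x\<^sup>2 + 2 * of_int q * x + of_int r = 0"
      using that(3) by (simp add: map_poly_pCons pderiv_pCons algebra_simps power2_eq_square)
    ultimately show False using cubic_discriminant_eq_0_if_double_root assms(2) by blast
  qed
  then show ?thesis unfolding elliptic_curve_def using \<open>p \<noteq> 0\<close> by auto
qed

lemma pos_int_points_cubic:
  "(x, y) \<in> pos_int_points [: s, r, q, p :] \<longleftrightarrow>
     0 < x \<and> 0 < y \<and> y\<^sup>2 = p * x ^ 3 + q * x\<^sup>2 + r * x + s"
proof -
  have "poly (map_poly of_int [: s, r, q, p :]) (of_int x) =
      (of_int (p * x ^ 3 + q * x\<^sup>2 + r * x + s) :: complex)"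
    by (simp add: map_poly_pCons algebra_simps power2_eq_square power3_eq_cube)
  then have "(of_int x, of_int y) \<in> curve [: s, r, q, p :] \<longleftrightarrow>
      (of_int (y\<^sup>2) :: complex) = of_int (p * x ^ 3 + q * x\<^sup>2 + r * x + s)"
    unfolding curve_def by simp
  then show ?thesis unfolding pos_int_points_def by (simp only: of_int_eq_iff) simp
qed

section \<open>The linear system\<close>

lemma UNIV_7: "(UNIV :: 7 set) = {1, 2, 3, 4, 5, 6, 7}"
proof -
  have "x = 1 \<or> x = 2 \<or> x = 3 \<or> x = 4 \<or> x = 5 \<or> x = 6 \<or> x = 7" for x :: 7
  proof (induct x)
    case (of_int z)
    then have "z = 0 \<or> z = 1 \<or> z = 2 \<or> z = 3 \<or> z = 4 \<or> z = 5 \<or> z = 6" by auto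
    then show ?case by auto
  qed
  then show ?thesis by auto
qed

lemma sum_7: "sum f (UNIV :: 7 set) = f 1 + f 2 + f 3 + f 4 + f 5 + f 6 + f 7"
  unfolding UNIV_7 by (simp add: ac_simps)

text \<open>
  Naming the vector by an equation fixes its dimension once for all seven components;
  instantiating the equation with reflexivity gives the rewrite rules.
\<close>

lemma vector_7:
  fixes v :: "'a::zero ^ 7"
  assumes "v = vector [x1, x2, x3, x4, x5, x6, x7]"
  shows "v $ 1 = x1" "v $ 2 = x2" "v $ 3 = x3" "v $ 4 = x4" "v $ 5 = x5" "v $ 6 = x6" "v $ 7 = x7"
  unfolding assms vector_def by simp_all

theorem theorem10:
  fixes a :: "nat \<Rightarrow> nat \<Rightarrow> int"
    and A :: "int ^ 7 ^ 3"
    and S :: "(int ^ 7) set"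
    and E :: "int ^ 7 \<Rightarrow> int poly"
    and k u t :: int
  assumes A_def: "A = vector
        [vector [a 1 1, - a 1 2, a 1 3, - a 1 4, 0, 0, 0],
         vector [a 2 1, - a 2 2, a 2 3, 0, 4 * a 2 5, 4 * a 2 6, 4 * a 2 7],
         vector [- 3 * a 3 1, 0, a 3 3, 0, 4 * a 3 5, 4 * a 3 6, 4 * a 3 7]]"
    and S_def: "S = {c. A *v c = vector [k\<^sup>2, 4 * u - 1, 4 * t - 1]}"
    and col1: "a 1 1 = a 2 1" "a 2 1 = a 3 1"
    and col2: "a 1 2 = a 2 2"
    and col3: "a 1 3 = a 2 3" "a 2 3 = a 3 3"
    and k: "k > 0" "odd k"
    and k_primes: "\<And>p. prime p \<Longrightarrow> p dvd k \<Longrightarrow> [p = 1] (mod 4)"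
    and E_def: "\<And>c. E c = [: a 1 4 * c $ 4, a 1 3 * c $ 3, a 1 2 * c $ 2, a 1 1 * c $ 1 :]"
  shows "\<forall>s\<in>S.
    (a 1 1 * s $ 1 \<noteq> 0 \<and>
     cubic_discriminant (a 1 1 * s $ 1) (a 1 2 * s $ 2) (a 1 3 * s $ 3) (a 1 4 * s $ 4) \<noteq> 0
       \<longrightarrow> elliptic_curve (E s)) \<and>
    ((\<forall>(x, y) \<in> pos_int_points (E s). x > 1 \<and> y \<ge> 1) \<longrightarrow> pos_int_points (E s) = {})"
proof (intro ballI conjI impI)
  fix s assume "s \<in> S"
  let ?p = "a 1 1 * s $ 1" and ?q = "a 1 2 * s $ 2" and ?r = "a 1 3 * s $ 3" and ?s = "a 1 4 * s $ 4"
  show "elliptic_curve (E s)" if "?p \<noteq> 0 \<and> cubic_discriminant ?p ?q ?r ?s \<noteq> 0"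
    unfolding E_def using that elliptic_curve_if_cubic_discriminant_neq_0 by blast
  have rows: "(A *v s) $ 1 = k\<^sup>2" "(A *v s) $ 2 = 4 * u - 1" "(A *v s) $ 3 = 4 * t - 1"
    using \<open>s \<in> S\<close> unfolding S_def by simp_all
  have row1: "?p - ?q + ?r - ?s = k\<^sup>2"
    using rows(1) by (simp add: A_def matrix_vector_mult_def sum_7 vector_7[OF refl])
  \<comment> \<open>Moving \<open>3\<close> to the left turns the constants \<open>4u - 1\<close> and \<open>4t - 1\<close> into multiples of \<open>4\<close>.\<close>
  have "a 2 1 * s $ 1 - a 2 2 * s $ 2 + a 2 3 * s $ 3 - 3
      = 4 * (u - 1 - a 2 5 * s $ 5 - a 2 6 * s $ 6 - a 2 7 * s $ 7)"
    using rows(2) by (simp add: A_def matrix_vector_mult_def sum_7 vector_7[OF refl] algebra_simps)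
  then have row2: "[?p - ?q + ?r = 3] (mod 4)"
    unfolding col1(1) col2 col3(1) cong_iff_dvd_diff by (rule dvdI)
  have "a 3 3 * s $ 3 - 3 * (a 3 1 * s $ 1) - 3
      = 4 * (t - 1 - a 3 5 * s $ 5 - a 3 6 * s $ 6 - a 3 7 * s $ 7)"
    using rows(3) by (simp add: A_def matrix_vector_mult_def sum_7 vector_7[OF refl] algebra_simps)
  then have row3: "[?r - 3 * ?p = 3] (mod 4)"
    unfolding col1 col3 cong_iff_dvd_diff by (rule dvdI)
  have "(x, y) \<notin> pos_int_points (E s)" for x y
  proof
    assume "(x, y) \<in> pos_int_points (E s)"
    then have x: "0 < x" and y: "y\<^sup>2 = ?p * x ^ 3 + ?q * x\<^sup>2 + ?r * x + ?s"
      by (simp_all only: E_def pos_int_points_cubic)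
    show False
      by (rule no_solution_pos_abscissa[OF k(2) k_primes row1 row2 row3 x y])
  qed
  then show "pos_int_points (E s) = {}" by auto
qed

end
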